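(* Let $n\ge 1$ and let $\mathcal{A}$ be the $n$-dimensional null-filiform associative algebra over $\mathbb{C}$ with basis $e_1,\dots,e_n$. Let $d:\mathcal{A}\to\mathcal{A}$ be a differential operator of weight $1$. Then there exist $\alpha_1,\dots,\alpha_n\in\mathbb{C}$ such that for all $1\le k\le n$ \[ d(e_k)= \sum_{l=k}^{n} \Big( \sum_{i_1+\dots+i_k=l} \alpha_{i_1}\cdots\alpha_{i_k}\Big) e_{l}-e_k ,\] where the inner sum runs over all $k$-tuples $(i_1,\dots,i_k)$ of integers $1\le i_1,\dots,i_k\le n$ with $i_1+\dots+i_k=l$.
   Context: The $n$-dimensional null-filiform associative algebra $\mathcal{A}$ over $\mathbb{C}$ has basis $e_1,\dots,e_n$ and bilinear product $e_ie_j=e_{i+j}$ if $i+j\le n$, and $e_ie_j=0$ otherwise. A differential operator of weight $\lambda$ on $\mathcal{A}$ is a $\mathbb{C}$-linear map $d:\mathcal{A}\to\mathcal{A}$ with $d(xy)=d(x)y+xd(y)+\lambda d(x)d(y)$ for all $x,y\in\mathcal{A}$. *)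

theory Defs
  imports Complex_Main
begin

text \<open>
  The algebra is given abstractly, by a basis \<open>e 1, \<dots>, e n\<close> of a complex vector space and a
  bilinear product with the prescribed table; associativity is a consequence of these axioms.
  Injectivity of \<open>e\<close> is needed because \<open>independent\<close> only speaks about the set of values.
\<close>

locale null_filiform_algebra = vector_space scale
  for scale :: "complex \<Rightarrow> 'a::ab_group_add \<Rightarrow> 'a" (infixr \<open>*s\<close> 75) +
  fixes mult :: "'a \<Rightarrow> 'a \<Rightarrow> 'a" (infixl \<open>\<bullet>\<close> 70)
    and e :: "nat \<Rightarrow> 'a"
    and n :: nat
  assumes linear_mult_right: "\<And>x. Vector_Spaces.linear (*s) (*s) (\<lambda>y. x \<bullet> y)"
    and linear_mult_left: "\<And>y. Vector_Spaces.linear (*s) (*s) (\<lambda>x. x \<bullet> y)"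
    and basis_inj: "inj_on e {1..n}"
    and basis_independent: "independent (e ` {1..n})"
    and basis_span: "span (e ` {1..n}) = UNIV"
    and mult_basis: "\<And>i j. i \<in> {1..n} \<Longrightarrow> j \<in> {1..n} \<Longrightarrow>
      e i \<bullet> e j = (if i + j \<le> n then e (i + j) else 0)"

definition differential_operator ::
    "(complex \<Rightarrow> 'a::ab_group_add \<Rightarrow> 'a) \<Rightarrow> ('a \<Rightarrow> 'a \<Rightarrow> 'a) \<Rightarrow> complex \<Rightarrow> ('a \<Rightarrow> 'a) \<Rightarrow> bool" where
  "differential_operator scale mult lam d \<longleftrightarrow>
     Vector_Spaces.linear scale scale d \<and>
     (\<forall>x y. d (mult x y) = mult (d x) y + mult x (d y) + scale lam (mult (d x) (d y)))"

end

theory Submission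
  imports Defs
begin

text \<open>
  If \<open>d\<close> is a differential operator of weight 1, then \<open>\<phi> x = d x + x\<close> is multiplicative. Writing
  \<open>\<phi> (e 1) = (\<Sum>i = 1..n. \<alpha> i *s e i)\<close>, the claim is the expansion of \<open>\<phi> (e k) = \<phi> (e 1) ^ k\<close> over
  all \<open>k\<close>-tuples of indices, grouped by the sum of the tuple.
\<close>

context null_filiform_algebra
begin

text \<open>The families and index sets are arbitrary because the right factor will be a sum indexed
  by tuples, whose vectors may repeat or vanish.\<close>

lemma mult_sum_sum:
  "(\<Sum>i\<in>A. a i *s f i) \<bullet> (\<Sum>j\<in>B. b j *s g j) = (\<Sum>i\<in>A. \<Sum>j\<in>B. (a i * b j) *s (f i \<bullet> g j))"
proof -
  have "(\<Sum>i\<in>A. a i *s f i) \<bullet> y = (\<Sum>i\<in>A. a i *s (f i \<bullet> y))" for y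
  proof -
    interpret L: Vector_Spaces.linear "(*s)" "(*s)" "\<lambda>x. x \<bullet> y" by (rule linear_mult_left)
    show ?thesis by (simp add: L.sum L.scale)
  qed
  note left = this
  have "x \<bullet> (\<Sum>j\<in>B. b j *s g j) = (\<Sum>j\<in>B. b j *s (x \<bullet> g j))" for x
  proof -
    interpret R: Vector_Spaces.linear "(*s)" "(*s)" "\<lambda>y. x \<bullet> y" by (rule linear_mult_right)
    show ?thesis by (simp add: R.sum R.scale)
  qed
  note right = this
  show ?thesis
    unfolding left unfolding right scale_sum_right by simp
qed

lemma basis_expansion: "\<exists>a. x = (\<Sum>i = 1..n. a i *s e i)"
proof -
  have "x \<in> span (e ` {1..n})" unfolding basis_span ..
  then obtain u where "x = (\<Sum>v\<in>e ` {1..n}. u v *s v)"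
    by (auto simp: span_finite)
  then have "x = (\<Sum>i = 1..n. u (e i) *s e i)"
    unfolding sum.reindex[OF basis_inj] by simp
  then show ?thesis by (rule exI[where x = "\<lambda>i. u (e i)"])
qed

text \<open>Builds the truncation of the product table into the vector, so that expansions can run
  over all tuples, whatever their total.\<close>

definition basis_or_zero :: "nat \<Rightarrow> 'a" where
  "basis_or_zero m = (if m \<le> n then e m else 0)"

text \<open>Once an index exceeds \<open>n\<close> it stays beyond \<open>n\<close>, so no case
  split survives. The bound \<open>m \<ge> 1\<close> matters: nothing is known about
  \<open>e 0\<close>.\<close>

lemma mult_basis_or_zero:
  assumes "i \<in> {1..n}" and "m \<ge> 1"
  shows "e i \<bullet> basis_or_zero m = basis_or_zero (i + m)"
proof -
  interpret R: Vector_Spaces.linear "(*s)" "(*s)" "\<lambda>y. e i \<bullet> y" by (rule linear_mult_right)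
  show ?thesis using assms by (auto simp: basis_or_zero_def mult_basis R.zero)
qed

lemma le_sum_list_of_positive:
  fixes xs :: "nat list"
  assumes "set xs \<subseteq> {1..n}"
  shows "length xs \<le> sum_list xs"
  using assms by (induction xs) auto

text \<open>Induction on \<open>k\<close> through \<open>e (Suc k) = e 1 \<bullet> e k\<close>:
  multiplying by \<open>\<phi> (e 1)\<close> prepends one index to each tuple.\<close>

lemma multiplicative_basis_image:
  assumes phi_mult: "\<And>x y. \<phi> (x \<bullet> y) = \<phi> x \<bullet> \<phi> y"
    and phi_e1: "\<phi> (e 1) = (\<Sum>i = 1..n. \<alpha> i *s e i)"
    and "1 \<le> k" and "k \<le> n"
  shows "\<phi> (e k) = (\<Sum>is | set is \<subseteq> {1..n} \<and> length is = k.
    prod_list (map \<alpha> is) *s basis_or_zero (sum_list is))"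
  using \<open>1 \<le> k\<close> \<open>k \<le> n\<close>
proof (induction k rule: dec_induct)
  case base
  have "{is. set is \<subseteq> {1..n} \<and> length is = 1} = (\<lambda>i. [i]) ` {1..n}"
    by (auto simp: length_Suc_conv)
  then show ?case
    by (simp add: sum.reindex inj_on_def phi_e1[unfolded One_nat_def] basis_or_zero_def)
next
  case (step k)
  let ?L = "{is. set is \<subseteq> {1..n} \<and> length is = k}"
  have "e (Suc k) = e 1 \<bullet> e k" using step by (simp add: mult_basis)
  then have "\<phi> (e (Suc k)) = \<phi> (e 1) \<bullet> \<phi> (e k)" by (simp add: phi_mult)
  also have "\<dots> = (\<Sum>i = 1..n. \<Sum>is\<in>?L.
      (\<alpha> i * prod_list (map \<alpha> is)) *s (e i \<bullet> basis_or_zero (sum_list is)))"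
    using step by (simp add: phi_e1[unfolded One_nat_def] mult_sum_sum)
  also have "\<dots> = (\<Sum>i = 1..n. \<Sum>is\<in>?L.
      prod_list (map \<alpha> (i # is)) *s basis_or_zero (sum_list (i # is)))"
  proof (intro sum.cong refl)
    fix i "is" assume "i \<in> {1..n}" and "is \<in> ?L"
    then show "(\<alpha> i * prod_list (map \<alpha> is)) *s (e i \<bullet> basis_or_zero (sum_list is))
      = prod_list (map \<alpha> (i # is)) *s basis_or_zero (sum_list (i # is))"
      \<comment> \<open>The tuple has length \<open>k \<ge> 1\<close> and positive entries, so its
        total is at least 1.\<close>
      using le_sum_list_of_positive[of "is"] step(1) by (simp add: mult_basis_or_zero)
  qed
  \<comment> \<open>The sums are swapped so that the pairs have the order (tail, head) used in
    \<open>lists_length_Suc_eq\<close>.\<close>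
  also have "\<dots> = (\<Sum>(is, i)\<in>?L \<times> {1..n}.
      prod_list (map \<alpha> (i # is)) *s basis_or_zero (sum_list (i # is)))"
    by (subst sum.swap) (simp add: sum.cartesian_product)
  also have "\<dots> = (\<Sum>is | set is \<subseteq> {1..n} \<and> length is = Suc k.
      prod_list (map \<alpha> is) *s basis_or_zero (sum_list is))"
    unfolding lists_length_Suc_eq
    by (subst sum.reindex) (auto simp: inj_on_def split_beta)
  finally show ?case .
qed

text \<open>Tuples with total above \<open>n\<close> contribute zero; the others have total between
  \<open>k\<close> and \<open>n\<close>, as each of the \<open>k\<close> entries is at least 1, and
  are grouped by it.\<close>

lemma sum_tuples_by_total:
  "(\<Sum>is | set is \<subseteq> {1..n} \<and> length is = k. f is *s basis_or_zero (sum_list is))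
    = (\<Sum>l = k..n. (\<Sum>is | length is = k \<and> set is \<subseteq> {1..n} \<and> sum_list is = l. f is) *s e l)"
proof -
  let ?L = "{is. set is \<subseteq> {1..n} \<and> length is = k}"
  let ?M = "{is \<in> ?L. sum_list is \<le> n}"
  have fin: "finite ?L" by (rule finite_lists_length_eq) simp
  then have finM: "finite ?M" by (rule rev_finite_subset) auto
  have "(\<Sum>is\<in>?L. f is *s basis_or_zero (sum_list is)) = (\<Sum>is\<in>?M. f is *s e (sum_list is))"
    using fin by (intro sum.mono_neutral_cong_right) (auto simp: basis_or_zero_def)
  also have "\<dots> = (\<Sum>l = k..n. \<Sum>is | is \<in> ?M \<and> sum_list is = l. f is *s e (sum_list is))"
    using finM le_sum_list_of_positive by (intro sum.group[symmetric]) auto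
  also have "\<dots> = (\<Sum>l = k..n.
      (\<Sum>is | length is = k \<and> set is \<subseteq> {1..n} \<and> sum_list is = l. f is) *s e l)"
    unfolding scale_sum_left by (intro sum.cong refl) auto
  finally show ?thesis .
qed

text \<open>Weight 1 supplies exactly the term \<open>d x \<bullet> d y\<close> in the expansion of
  the right-hand product.\<close>

lemma differential_operator_add_id_mult:
  assumes "differential_operator (*s) (\<bullet>) 1 d"
  shows "d (x \<bullet> y) + x \<bullet> y = (d x + x) \<bullet> (d y + y)"
proof -
  have "(u + v) \<bullet> w = u \<bullet> w + v \<bullet> w" for u v w
    using linear_mult_left[of w] unfolding Vector_Spaces.linear_iff by blast
  moreover have "u \<bullet> (v + w) = u \<bullet> v + u \<bullet> w" for u v w
    using linear_mult_right[of u] unfolding Vector_Spaces.linear_iff by blast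
  ultimately show ?thesis
    using assms by (simp add: differential_operator_def algebra_simps)
qed

end

theorem theorem3p3:
  fixes scale :: "complex \<Rightarrow> 'a::ab_group_add \<Rightarrow> 'a"
    and mult :: "'a \<Rightarrow> 'a \<Rightarrow> 'a"
    and e :: "nat \<Rightarrow> 'a"
    and n :: nat
    and d :: "'a \<Rightarrow> 'a"
  assumes "n \<ge> 1"
    and "null_filiform_algebra scale mult e n"
    and "differential_operator scale mult 1 d"
  shows "\<exists>\<alpha> :: nat \<Rightarrow> complex. \<forall>k\<in>{1..n}.
    d (e k) =
      (\<Sum>l = k..n.
         scale (\<Sum>is | length is = k \<and> set is \<subseteq> {1..n} \<and> sum_list is = l. prod_list (map \<alpha> is))
           (e l)) - e k"
proof -
  interpret null_filiform_algebra scale mult e n by fact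
  obtain \<alpha> where "d (e 1) + e 1 = (\<Sum>i = 1..n. scale (\<alpha> i) (e i))"
    using basis_expansion by blast
  then have "d (e k) + e k = (\<Sum>is | set is \<subseteq> {1..n} \<and> length is = k.
      scale (prod_list (map \<alpha> is)) (basis_or_zero (sum_list is)))" if "k \<in> {1..n}" for k
    using that multiplicative_basis_image[of "\<lambda>x. d x + x" \<alpha> k]
      differential_operator_add_id_mult[OF assms(3)] by auto
  then show ?thesis
    unfolding sum_tuples_by_total by (auto simp only: eq_diff_eq)
qed

end
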